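(* Let $\mathcal{M} = \langle \mathcal{S},\mathcal{A},\tau,\mu_0,\_,\gamma\rangle$ be an environment (an MDP without a reward function) and let $R_1, R_2 \in \mathcal{R}$ be reward functions. Then $R_1 \equiv_{\mathrm{ORD}^{\mathcal{M}}} R_2$ (that is, $R_1$ and $R_2$ induce the same ordering of policies in $\mathcal{M}$) if and only if $R_2 = t(R_1)$ for some $t \in S'\mathrm{R}_\tau \circ \mathrm{PS}_\gamma \circ \mathrm{LS}$.
   Context: $\mathcal{S}$ (states) and $\mathcal{A}$ (actions) are finite sets; $\tau$ maps each $(s,a)\in\mathcal{S}\times\mathcal{A}$ to a probability distribution on $\mathcal{S}$; $\mu_0$ is a probability distribution on $\mathcal{S}$ (initial state distribution); $\gamma\in(0,1]$ is the discount. All states are assumed reachable under $\tau$ and $\mu_0$. $\mathcal{R}$ is the set of all functions $R:\mathcal{S}\times\mathcal{A}\times\mathcal{S}\to\mathbb{R}$. A policy $\pi$ maps each state to a probability distribution on $\mathcal{A}$. For a reward $R_i$, $\mathcal{J}_i(\pi)=\mathbb{E}_{\xi\sim\pi}\left[\sum_{t=0}^\infty \gamma^t R_i(s_t,a_t,s_{t+1})\right]$, where $\xi=\langle s_0,a_0,s_1,a_1,\dots\rangle$ is generated by $s_0\sim\mu_0$, $a_t\sim\pi(s_t)$, $s_{t+1}\sim\tau(s_t,a_t)$; these quantities are taken to be well-defined real numbers. $R_1\equiv_{\mathrm{ORD}^{\mathcal{M}}}R_2$ means: for all policies $\pi,\pi'$, $\mathcal{J}_1(\pi)>\mathcal{J}_1(\pi')$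 if and only if $\mathcal{J}_2(\pi)>\mathcal{J}_2(\pi')$. A reward transformation is a function $t:\mathcal{R}\to\mathcal{R}$. - $\mathrm{PS}_\gamma$ is the set of all $t$ such that for each $R$ there is $\Phi:\mathcal{S}\to\mathbb{R}$ with $t(R)(s,a,s')=R(s,a,s')+\gamma\Phi(s')-\Phi(s)$ for all $s,a,s'$ (potential shaping). - $S'\mathrm{R}_\tau$ is the set of all $t$ such that for each $R$ and all $s,a$, $\mathbb{E}_{S'\sim\tau(s,a)}[t(R)(s,a,S')]=\mathbb{E}_{S'\sim\tau(s,a)}[R(s,a,S')]$ ($S'$-redistribution). - $\mathrm{LS}$ is the set of all $t$ such that for each $R$ there is a real $c>0$ with $t(R)=c\cdot R$. In each case $\Phi$, $c$, etc. may depend on $R$. For sets $F,G$ of reward transformations, $F\circ G$ is the set of all transformations obtained by composing transformations in $F$ and $G$ arbitrarily, in any order. *)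

theory Defs
  imports "HOL-Probability.Probability"
begin

text \<open>
  States and actions are the elements of the types 's and 'a (both of class finite in the
  theorem). An environment is given by a transition function \<tau>, an initial state distribution
  \<mu>0 and a discount \<gamma>.
\<close>

type_synonym ('s, 'a) transition = "'s \<Rightarrow> 'a \<Rightarrow> 's pmf"
type_synonym ('s, 'a) policy = "'s \<Rightarrow> 'a pmf"
type_synonym ('s, 'a) reward = "'s \<Rightarrow> 'a \<Rightarrow> 's \<Rightarrow> real"
type_synonym ('s, 'a) transformation = "('s, 'a) reward \<Rightarrow> ('s, 'a) reward"

inductive reachable :: "('s, 'a) transition \<Rightarrow> 's pmf \<Rightarrow> 's \<Rightarrow> bool"
  for \<tau> :: "('s, 'a) transition" and \<mu>0 :: "'s pmf" where
  init: "s \<in> set_pmf \<mu>0 \<Longrightarrow> reachable \<tau> \<mu>0 s"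
| step: "reachable \<tau> \<mu>0 s \<Longrightarrow> s' \<in> set_pmf (\<tau> s a) \<Longrightarrow> reachable \<tau> \<mu>0 s'"


subsection \<open>The distribution of trajectories and the policy value\<close>

text \<open>
  A trajectory is a function \<xi> with \<xi> t = (s_t, a_t). The following is the conditional distribution
  of \<xi> t given \<xi> 0, ..., \<xi> (t - 1); trajectories are distributed according to the measure that the
  Ionescu-Tulcea theorem yields for these kernels.
\<close>

definition step_kernel ::
  "('s, 'a) transition \<Rightarrow> 's pmf \<Rightarrow> ('s, 'a) policy \<Rightarrow> nat \<Rightarrow> (nat \<Rightarrow> 's \<times> 'a) \<Rightarrow> ('s \<times> 'a) pmf" where
  "step_kernel \<tau> \<mu>0 \<pi> t \<xi> =
     bind_pmf (case t of 0 \<Rightarrow> \<mu>0 | Suc u \<Rightarrow> \<tau> (fst (\<xi> u)) (snd (\<xi> u)))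
       (\<lambda>s. map_pmf (Pair s) (\<pi> s))"

lemma Ionescu_Tulcea_step_kernel:
  "Ionescu_Tulcea (\<lambda>t \<xi>. measure_pmf (step_kernel \<tau> \<mu>0 \<pi> t \<xi>)) (\<lambda>_. count_space UNIV)"
proof
  fix i :: nat
  show "(\<lambda>\<xi>. measure_pmf (step_kernel \<tau> \<mu>0 \<pi> i \<xi>))
      \<in> measurable (PiM {0..<i} (\<lambda>_. count_space UNIV)) (subprob_algebra (count_space UNIV))"
  proof (cases i)
    case 0
    have "measure_pmf p \<in> space (subprob_algebra (count_space UNIV))" for p :: "('a \<times> 'b) pmf"
      by (simp add: space_subprob_algebra measure_pmf.subprob_space_axioms)
    then show ?thesis using 0 by (simp add: step_kernel_def)
  next
    case (Suc u)
    have sp: "measure_pmf p \<in> space (subprob_algebra (count_space UNIV))" for p :: "('a \<times> 'b) pmf"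
      by (simp add: space_subprob_algebra measure_pmf.subprob_space_axioms)
    have 1: "(\<lambda>\<xi>. \<xi> u) \<in> measurable (PiM {0..<i} (\<lambda>_. count_space UNIV :: ('a \<times> 'b) measure))
        (count_space UNIV)"
      using Suc by (intro measurable_component_singleton) auto
    have 2: "(\<lambda>x. measure_pmf (bind_pmf (\<tau> (fst x) (snd x)) (\<lambda>s. map_pmf (Pair s) (\<pi> s))))
        \<in> measurable (count_space UNIV) (subprob_algebra (count_space UNIV))"
      using sp by simp
    show ?thesis
      using measurable_compose[OF 1 2] Suc by (simp add: step_kernel_def)
  qed
qed

definition trajectories ::
  "('s, 'a) transition \<Rightarrow> 's pmf \<Rightarrow> ('s, 'a) policy \<Rightarrow> (nat \<Rightarrow> 's \<times> 'a) measure" where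
  "trajectories \<tau> \<mu>0 \<pi> =
     projective_family.lim UNIV
       (Ionescu_Tulcea.CI (\<lambda>t \<xi>. measure_pmf (step_kernel \<tau> \<mu>0 \<pi> t \<xi>)) (\<lambda>_. count_space UNIV))
       (\<lambda>_. count_space UNIV)"

lemma sets_trajectories:
  "sets (trajectories \<tau> \<mu>0 \<pi>) = sets (PiM UNIV (\<lambda>_. count_space UNIV))"
proof -
  interpret Ionescu_Tulcea "\<lambda>t \<xi>. measure_pmf (step_kernel \<tau> \<mu>0 \<pi> t \<xi>)" "\<lambda>_. count_space UNIV"
    by (rule Ionescu_Tulcea_step_kernel)
  show ?thesis by (simp add: trajectories_def PF.sets_lim)
qed

lemma prob_space_trajectories: "prob_space (trajectories \<tau> \<mu>0 \<pi>)"
proof -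
  interpret Ionescu_Tulcea "\<lambda>t \<xi>. measure_pmf (step_kernel \<tau> \<mu>0 \<pi> t \<xi>)" "\<lambda>_. count_space UNIV"
    by (rule Ionescu_Tulcea_step_kernel)
  have "prob_space (distr PF.lim (PiM {} (\<lambda>_. count_space UNIV)) (\<lambda>x. restrict x {}))"
    by (subst distr_lim) (auto intro: PF.prob_space_P)
  then have "prob_space PF.lim"
    by (rule prob_space_distrD[rotated])
       (auto simp: measurable_cong_sets[OF PF.sets_lim refl] intro!: measurable_restrict)
  then show ?thesis by (simp add: trajectories_def)
qed

lemma emeasure_trajectories_prefix:
  "emeasure (trajectories \<tau> \<mu>0 \<pi>) {\<xi>. \<forall>i<n. \<xi> i = w i} =
     (\<Prod>i<n. ennreal (pmf (step_kernel \<tau> \<mu>0 \<pi> i w) (w i)))"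
proof -
  interpret Ionescu_Tulcea "\<lambda>t \<xi>. measure_pmf (step_kernel \<tau> \<mu>0 \<pi> t \<xi>)"
      "\<lambda>_. count_space UNIV :: ('a \<times> 'b) measure"
    by (rule Ionescu_Tulcea_step_kernel)
  let ?M = "\<lambda>_::nat. count_space UNIV :: ('a \<times> 'b) measure"
  let ?X = "\<lambda>n. PiE {0..<n} (\<lambda>i. {w i})"
  have X: "?X n \<in> sets (PiM {0..<n} ?M)" for n
    by (intro sets_PiM_I_finite) auto
  have kern: "step_kernel \<tau> \<mu>0 \<pi> n (restrict w {0..<n}) = step_kernel \<tau> \<mu>0 \<pi> n w" for n
    by (cases n) (auto simp: step_kernel_def)
  have C: "emeasure (C 0 n (\<lambda>_. undefined)) (?X n) =
      (\<Prod>i<n. ennreal (pmf (step_kernel \<tau> \<mu>0 \<pi> i w) (w i)))"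
  proof (induction n)
    case 0
    have "?X 0 = {\<lambda>_. undefined}" by auto
    then show ?case using X[of 0] by (simp add: emeasure_return)
  next
    case (Suc n)
    have sp: "(\<lambda>_. undefined) \<in> space (PiM {0..<0} ?M)" by (simp add: space_PiM)
    interpret Cn: prob_space "C 0 n (\<lambda>_. undefined)" by (rule prob_space_C[OF sp])
    have eP: "eP n \<in> measurable (C 0 n (\<lambda>_. undefined)) (subprob_algebra (PiM {0..<Suc n} ?M))"
      by (subst measurable_cong_sets[OF sets_C[OF sp, of n] refl]) (simp add: measurable_eP)
    have 1: "emeasure (C 0 (Suc n) (\<lambda>_. undefined)) (?X (Suc n)) =
        (\<integral>\<^sup>+ x. emeasure (eP n x) (?X (Suc n)) \<partial>C 0 n (\<lambda>_. undefined))"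
      using emeasure_bind[OF Cn.not_empty eP X] by simp
    have 2: "emeasure (eP n x) (?X (Suc n)) =
        ennreal (pmf (step_kernel \<tau> \<mu>0 \<pi> n w) (w n)) * indicator (?X n) x"
      if x: "x \<in> space (PiM {0..<n} ?M)" for x
    proof -
      have ext: "x \<in> extensional {0..<n}" using x by (auto simp: space_PiM PiE_iff)
      show ?thesis
      proof (cases "x \<in> ?X n")
        case True
        then have xw: "x = restrict w {0..<n}" by (auto simp: PiE_iff extensional_def fun_eq_iff)
        have V: "(\<lambda>y. x(n := y)) -` ?X (Suc n) \<inter> space (?M n) = {w n}"
          unfolding xw by (auto simp: PiE_iff extensional_def atLeastLessThanSuc)
        show ?thesis
          unfolding emeasure_eP[OF x X] V using True
          by (simp add: xw kern emeasure_pmf_single)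
      next
        case False
        have V: "(\<lambda>y. x(n := y)) -` ?X (Suc n) \<inter> space (?M n) = {}"
          using False ext by (auto simp: PiE_iff less_Suc_eq split: if_splits)
        show ?thesis
          unfolding emeasure_eP[OF x X] V using False by simp
      qed
    qed
    have "emeasure (C 0 (Suc n) (\<lambda>_. undefined)) (?X (Suc n)) =
        (\<integral>\<^sup>+ x. ennreal (pmf (step_kernel \<tau> \<mu>0 \<pi> n w) (w n)) * indicator (?X n) x
          \<partial>C 0 n (\<lambda>_. undefined))"
      unfolding 1 by (intro nn_integral_cong 2) (simp add: space_C[OF sp])
    also have "\<dots> = ennreal (pmf (step_kernel \<tau> \<mu>0 \<pi> n w) (w n)) *
        emeasure (C 0 n (\<lambda>_. undefined)) (?X n)"
      using X[of n] by (subst nn_integral_cmult_indicator) (auto simp: sets_C[OF sp])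
    finally show ?case by (simp add: Suc mult.commute)
  qed
  have "{\<xi>. \<forall>i<n. \<xi> i = w i} = prod_emb UNIV ?M {0..<n} (?X n)"
    by (auto simp: prod_emb_def space_PiM PiE_iff)
  then have "emeasure (trajectories \<tau> \<mu>0 \<pi>) {\<xi>. \<forall>i<n. \<xi> i = w i} =
      emeasure (CI {0..<n}) (?X n)"
    using lim[OF _ X] by (simp add: trajectories_def)
  also have "\<dots> = emeasure (C 0 n (\<lambda>_. undefined)) (prod_emb {0..<n} ?M {0..<n} (?X n))"
    by (rule emeasure_CI[OF subset_refl X])
  also have "prod_emb {0..<n} ?M {0..<n} (?X n) = ?X n"
    by (rule prod_emb_id) (auto simp: space_PiM PiE_iff)
  finally show ?thesis using C by simp
qed

definition discounted_return :: "real \<Rightarrow> ('s, 'a) reward \<Rightarrow> (nat \<Rightarrow> 's \<times> 'a) \<Rightarrow> real" where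
  "discounted_return \<gamma> R \<xi> = (\<Sum>t. \<gamma> ^ t * R (fst (\<xi> t)) (snd (\<xi> t)) (fst (\<xi> (Suc t))))"

definition policy_value ::
  "('s, 'a) transition \<Rightarrow> 's pmf \<Rightarrow> real \<Rightarrow> ('s, 'a) reward \<Rightarrow> ('s, 'a) policy \<Rightarrow> real" where
  "policy_value \<tau> \<mu>0 \<gamma> R \<pi> = (\<integral>\<xi>. discounted_return \<gamma> R \<xi> \<partial>trajectories \<tau> \<mu>0 \<pi>)"

text \<open>
  Both the infinite series and the Bochner integral are total functions in HOL; this predicate says
  that the series converges almost surely and that its expectation exists.
\<close>

definition policy_value_welldefined ::
  "('s, 'a) transition \<Rightarrow> 's pmf \<Rightarrow> real \<Rightarrow> ('s, 'a) reward \<Rightarrow> ('s, 'a) policy \<Rightarrow> bool" where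
  "policy_value_welldefined \<tau> \<mu>0 \<gamma> R \<pi> \<longleftrightarrow>
     (AE \<xi> in trajectories \<tau> \<mu>0 \<pi>.
        summable (\<lambda>t. \<gamma> ^ t * R (fst (\<xi> t)) (snd (\<xi> t)) (fst (\<xi> (Suc t))))) \<and>
     integrable (trajectories \<tau> \<mu>0 \<pi>) (discounted_return \<gamma> R)"

text \<open>
  For discounts in (0,1], well-definedness of the policy value for all rewards and policies amounts
  to \<gamma> < 1: for \<gamma> = 1 the value of a nonzero constant reward diverges.
\<close>

lemma policy_value_welldefined_iff:
  fixes \<tau> :: "('s::finite, 'a::finite) transition"
  assumes "0 < \<gamma>" "\<gamma> \<le> 1"
  shows "(\<forall>R \<pi>. policy_value_welldefined \<tau> \<mu>0 \<gamma> R \<pi>) \<longleftrightarrow> \<gamma> < 1"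
proof
  assume wd: "\<forall>R \<pi>. policy_value_welldefined \<tau> \<mu>0 \<gamma> R \<pi>"
  obtain \<pi> :: "('s, 'a) policy" where True by blast
  interpret prob_space "trajectories \<tau> \<mu>0 \<pi>" by (rule prob_space_trajectories)
  have "AE \<xi> in trajectories \<tau> \<mu>0 \<pi>. summable (\<lambda>t. \<gamma> ^ t * 1)"
    using wd[rule_format, of "\<lambda>_ _ _. 1" \<pi>] by (simp add: policy_value_welldefined_def)
  then have "summable (\<lambda>t. \<gamma> ^ t)"
    by (simp add: AE_const)
  then show "\<gamma> < 1"
    using assms by (simp add: summable_geometric_iff)
next
  assume g: "\<gamma> < 1"
  show "\<forall>R \<pi>. policy_value_welldefined \<tau> \<mu>0 \<gamma> R \<pi>"
  proof (intro allI)
    fix R :: "('s, 'a) reward" and \<pi> :: "('s, 'a) policy"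
    interpret prob_space "trajectories \<tau> \<mu>0 \<pi>" by (rule prob_space_trajectories)
    define B where "B = Max (range (\<lambda>(s, a, s'). \<bar>R s a s'\<bar>))"
    have B: "\<bar>R s a s'\<bar> \<le> B" for s a s'
      unfolding B_def by (rule Max_ge) (auto intro: image_eqI[of _ _ "(s, a, s')"])
    have gs: "summable (\<lambda>t. \<gamma> ^ t * B)"
      using assms g by (intro summable_mult2 summable_geometric) auto
    have le: "norm (\<gamma> ^ t * R (fst (\<xi> t)) (snd (\<xi> t)) (fst (\<xi> (Suc t)))) \<le> \<gamma> ^ t * B" for t \<xi>
      using assms B by (simp add: abs_mult mult_left_mono)
    have sm: "summable (\<lambda>t. \<gamma> ^ t * R (fst (\<xi> t)) (snd (\<xi> t)) (fst (\<xi> (Suc t))))" for \<xi>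
      by (rule summable_comparison_test'[OF gs le])
    have meas: "discounted_return \<gamma> R \<in> borel_measurable (trajectories \<tau> \<mu>0 \<pi>)"
    proof -
      have c: "(\<lambda>\<xi>. \<xi> t) \<in> measurable (PiM UNIV (\<lambda>_. count_space UNIV :: ('s \<times> 'a) measure))
          (count_space UNIV)" for t :: nat
        by (rule measurable_component_singleton) simp
      have p: "(\<lambda>\<xi>. (\<xi> t, \<xi> (Suc t))) \<in> measurable
          (PiM UNIV (\<lambda>_. count_space UNIV :: ('s \<times> 'a) measure)) (count_space UNIV)" for t :: nat
        using measurable_Pair[OF c c, of t "Suc t"] by (simp add: pair_measure_countable)
      have "(\<lambda>\<xi>. R (fst (\<xi> t)) (snd (\<xi> t)) (fst (\<xi> (Suc t)))) \<in> borel_measurable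
          (PiM UNIV (\<lambda>_. count_space UNIV :: ('s \<times> 'a) measure))" for t :: nat
        using measurable_compose[OF p[of t],
            of "\<lambda>(x, y). R (fst x) (snd x) (fst y)" borel] by simp
      then show ?thesis
        unfolding measurable_cong_sets[OF sets_trajectories refl] discounted_return_def[abs_def]
        by (intro borel_measurable_suminf borel_measurable_times borel_measurable_const)
    qed
    have "integrable (trajectories \<tau> \<mu>0 \<pi>) (discounted_return \<gamma> R)"
    proof (rule integrable_const_bound[OF _ meas, of "\<Sum>t. \<gamma> ^ t * B"], rule AE_I2)
      fix \<xi>
      show "norm (discounted_return \<gamma> R \<xi>) \<le> (\<Sum>t. \<gamma> ^ t * B)"
        unfolding discounted_return_def by (rule norm_suminf_le[OF le gs])
    qed
    then show "policy_value_welldefined \<tau> \<mu>0 \<gamma> R \<pi>"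
      using sm by (simp add: policy_value_welldefined_def)
  qed
qed

definition ord_equiv ::
  "('s, 'a) transition \<Rightarrow> 's pmf \<Rightarrow> real \<Rightarrow> ('s, 'a) reward \<Rightarrow> ('s, 'a) reward \<Rightarrow> bool" where
  "ord_equiv \<tau> \<mu>0 \<gamma> R1 R2 \<longleftrightarrow>
     (\<forall>\<pi> \<pi>'. policy_value \<tau> \<mu>0 \<gamma> R1 \<pi> > policy_value \<tau> \<mu>0 \<gamma> R1 \<pi>' \<longleftrightarrow>
             policy_value \<tau> \<mu>0 \<gamma> R2 \<pi> > policy_value \<tau> \<mu>0 \<gamma> R2 \<pi>')"


subsection \<open>Reward transformations\<close>

definition potential_shaping :: "real \<Rightarrow> ('s, 'a) transformation set" where
  "potential_shaping \<gamma> =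
     {t. \<forall>R. \<exists>\<Phi> :: 's \<Rightarrow> real. \<forall>s a s'. t R s a s' = R s a s' + \<gamma> * \<Phi> s' - \<Phi> s}"

definition redistribution :: "('s, 'a) transition \<Rightarrow> ('s, 'a) transformation set" where
  "redistribution \<tau> =
     {t. \<forall>R s a. measure_pmf.expectation (\<tau> s a) (\<lambda>s'. t R s a s') =
                 measure_pmf.expectation (\<tau> s a) (\<lambda>s'. R s a s')}"

definition linear_scaling :: "('s, 'a) transformation set" where
  "linear_scaling = {t. \<forall>R. \<exists>c>0. \<forall>s a s'. t R s a s' = c * R s a s'}"

text \<open>All compositions, of any length and in any order, of transformations from the two sets.\<close>

inductive_set compositions ::
  "('s, 'a) transformation set \<Rightarrow> ('s, 'a) transformation set \<Rightarrow> ('s, 'a) transformation set"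
  (infixl "\<odot>" 65)
  for F G :: "('s, 'a) transformation set" where
  left: "t \<in> F \<Longrightarrow> t \<in> F \<odot> G"
| right: "t \<in> G \<Longrightarrow> t \<in> F \<odot> G"
| comp: "t \<in> F \<odot> G \<Longrightarrow> u \<in> F \<odot> G \<Longrightarrow> t \<circ> u \<in> F \<odot> G"

end

theory Submission
  imports Defs
begin

text \<open>
  The value of a policy is the inner product of the mean reward with the discounted occupancy
  measure. The strictly positive occupancy measures of policies are exactly the strictly positive
  solutions of the flow equations, so from the uniform policy one can move a little in every
  flow-free direction. If two rewards order policies equally, the corresponding linear functionals
  on flow-free directions are therefore positive at the same places, hence positive multiples of
  each other. A functional that vanishes on all flow-free directions is a shaping term, because the
  shaping operator is minus the adjoint of the flow operator.
\<close>

section \<open>Marginals of the trajectory distribution\<close>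

lemma space_trajectories [simp]: "space (trajectories \<tau> \<mu>0 \<pi>) = UNIV"
  using sets_eq_imp_space_eq[OF sets_trajectories] by (simp add: space_PiM)

lemma measurable_coordinate:
  "(\<lambda>\<xi>. \<xi> t) \<in> measurable (trajectories \<tau> \<mu>0 \<pi>) (count_space UNIV)"
  unfolding measurable_cong_sets[OF sets_trajectories refl]
  by (rule measurable_component_singleton) simp

lemma coordinate_in_sets: "{\<xi>. \<xi> t = x} \<in> sets (trajectories \<tau> \<mu>0 \<pi>)"
proof -
  have "(\<lambda>\<xi>. \<xi> t) -` {x} \<inter> space (trajectories \<tau> \<mu>0 \<pi>) \<in> sets (trajectories \<tau> \<mu>0 \<pi>)"
    by (rule measurable_sets[OF measurable_coordinate]) simp
  then show ?thesis by (simp add: vimage_def)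
qed

lemma transition_in_sets:
  "{\<xi>. \<xi> t = x \<and> \<xi> (Suc t) = y} \<in> sets (trajectories \<tau> \<mu>0 \<pi>)"
proof -
  have "{\<xi>. \<xi> t = x} \<inter> {\<xi>. \<xi> (Suc t) = y} \<in> sets (trajectories \<tau> \<mu>0 \<pi>)"
    by (intro sets.Int coordinate_in_sets)
  then show ?thesis by (simp add: Int_def)
qed

lemma prefix_in_sets: "{\<xi>. \<forall>i<n. \<xi> i = w i} \<in> sets (trajectories \<tau> \<mu>0 \<pi>)"
\<comment> \<open>The empty prefix is treated apart: the intersection over \<open>i < n\<close> then
  has an empty index set.\<close>
proof (cases "n = 0")
  case True
  have "UNIV \<in> sets (trajectories \<tau> \<mu>0 \<pi>)"
    using sets.top[of "trajectories \<tau> \<mu>0 \<pi>"] by simp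
  with True show ?thesis by simp
next
  case False
  then have "{\<xi>. \<forall>i<n. \<xi> i = w i} = (\<Inter>i<n. {\<xi>. \<xi> i = w i})" by auto
  also have "\<dots> \<in> sets (trajectories \<tau> \<mu>0 \<pi>)"
    using False by (intro sets.finite_INT coordinate_in_sets) auto
  finally show ?thesis .
qed

lemma measure_prefix:
  "measure (trajectories \<tau> \<mu>0 \<pi>) {\<xi>. \<forall>i<n. \<xi> i = w i} =
     (\<Prod>i<n. pmf (step_kernel \<tau> \<mu>0 \<pi> i w) (w i))"
  unfolding measure_def emeasure_trajectories_prefix
  by (simp add: prod_ennreal prod_nonneg)

text \<open>With finitely many state-action pairs, the cylinders of length \<open>n\<close> form a
  finite partition of the trajectory space. Extensional functions on \<open>{..<n}\<close> name each
  cylinder exactly once. This carries the explicit cylinder probabilities over to events at later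
  times.\<close>

lemma measure_split_prefix:
  fixes \<tau> :: "('s::finite, 'a::finite) transition"
  assumes "E \<in> sets (trajectories \<tau> \<mu>0 \<pi>)"
  shows "measure (trajectories \<tau> \<mu>0 \<pi>) E =
    (\<Sum>w\<in>PiE {..<n} (\<lambda>_. UNIV). measure (trajectories \<tau> \<mu>0 \<pi>) ({\<xi>. \<forall>i<n. \<xi> i = w i} \<inter> E))"
proof -
  interpret prob_space "trajectories \<tau> \<mu>0 \<pi>" by (rule prob_space_trajectories)
  let ?P = "PiE {..<n} (\<lambda>_. UNIV :: ('s \<times> 'a) set)"
  have E: "E = (\<Union>w\<in>?P. {\<xi>. \<forall>i<n. \<xi> i = w i} \<inter> E)"
  proof (intro equalityI subsetI)
    fix \<xi> assume "\<xi> \<in> E"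
    then show "\<xi> \<in> (\<Union>w\<in>?P. {\<xi>. \<forall>i<n. \<xi> i = w i} \<inter> E)"
      by (intro UN_I[of "restrict \<xi> {..<n}"]) auto
  qed auto
  have "measure (trajectories \<tau> \<mu>0 \<pi>) (\<Union>w\<in>?P. {\<xi>. \<forall>i<n. \<xi> i = w i} \<inter> E) =
    (\<Sum>w\<in>?P. measure (trajectories \<tau> \<mu>0 \<pi>) ({\<xi>. \<forall>i<n. \<xi> i = w i} \<inter> E))"
  proof (rule finite_measure_finite_Union)
    show "finite ?P" by (intro finite_PiE) auto
    show "(\<lambda>w. {\<xi>. \<forall>i<n. \<xi> i = w i} \<inter> E) ` ?P \<subseteq> sets (trajectories \<tau> \<mu>0 \<pi>)"
      by (intro image_subsetI sets.Int prefix_in_sets assms)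
    show "disjoint_family_on (\<lambda>w. {\<xi>. \<forall>i<n. \<xi> i = w i} \<inter> E) ?P"
    proof (unfold disjoint_family_on_def, intro ballI impI)
      fix v w assume "v \<in> ?P" "w \<in> ?P" "v \<noteq> w"
      then obtain i where "i < n" "v i \<noteq> w i" using PiE_ext by blast
      then show "{\<xi>. \<forall>i<n. \<xi> i = v i} \<inter> E \<inter> ({\<xi>. \<forall>i<n. \<xi> i = w i} \<inter> E) = {}" by auto
    qed
  qed
  then show ?thesis by (simp only: E[symmetric])
qed

definition visit ::
  "('s, 'a) transition \<Rightarrow> 's pmf \<Rightarrow> ('s, 'a) policy \<Rightarrow> nat \<Rightarrow> 's \<times> 'a \<Rightarrow> real" where
  "visit \<tau> \<mu>0 \<pi> t x = measure (trajectories \<tau> \<mu>0 \<pi>) {\<xi>. \<xi> t = x}"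

lemma pmf_bind_pair:
  "pmf (bind_pmf p (\<lambda>s. map_pmf (Pair s) (\<pi> s))) (s, a) = pmf p s * pmf (\<pi> s) a"
proof -
  have "pmf (map_pmf (Pair s') (\<pi> s')) (s, a) = indicator {s} s' * pmf (\<pi> s) a" for s'
  proof (cases "s' = s")
    case True
    then show ?thesis by (simp add: pmf_map_inj' inj_def)
  next
    case False
    then have "(s, a) \<notin> set_pmf (map_pmf (Pair s') (\<pi> s'))" by auto
    then have "pmf (map_pmf (Pair s') (\<pi> s')) (s, a) = 0" by (simp only: set_pmf_iff not_not)
    with False show ?thesis by simp
  qed
  then show ?thesis by (simp add: pmf_bind measure_pmf_single)
qed

lemma visit_0: "visit \<tau> \<mu>0 \<pi> 0 (s, a) = pmf \<mu>0 s * pmf (\<pi> s) a"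
  using measure_prefix[of \<tau> \<mu>0 \<pi> 1 "\<lambda>_. (s, a)"]
  by (simp add: visit_def step_kernel_def pmf_bind_pair)

text \<open>This is the Markov property. Inside a fixed prefix of length \<open>t\<close>, the event
  and the event \<open>\<xi> t = x\<close> are both cylinders. Their probabilities differ by one
  last kernel factor, which depends on \<open>x\<close> and not on the prefix, so it can be pulled
  out of the sum over prefixes.\<close>

lemma measure_transition:
  fixes \<tau> :: "('s::finite, 'a::finite) transition"
  shows "measure (trajectories \<tau> \<mu>0 \<pi>) {\<xi>. \<xi> t = x \<and> \<xi> (Suc t) = (s', a')} =
    visit \<tau> \<mu>0 \<pi> t x * (pmf (\<tau> (fst x) (snd x)) s' * pmf (\<pi> s') a')"
proof -
  let ?T = "trajectories \<tau> \<mu>0 \<pi>"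
  let ?E = "{\<xi>. \<xi> t = x \<and> \<xi> (Suc t) = (s', a')}"
  let ?P = "PiE {..<t} (\<lambda>_. UNIV :: ('s \<times> 'a) set)"
  let ?k = "pmf (\<tau> (fst x) (snd x)) s' * pmf (\<pi> s') a'"
  have E: "?E \<in> sets ?T"
  by (rule transition_in_sets)
  have "measure ?T ({\<xi>. \<forall>i<t. \<xi> i = w i} \<inter> ?E) =
      measure ?T ({\<xi>. \<forall>i<t. \<xi> i = w i} \<inter> {\<xi>. \<xi> t = x}) * ?k" for w
  proof -
    \<comment> \<open>Extending the prefix by the two prescribed coordinates turns both events into
      prefix events of \<open>v\<close>, of lengths \<open>t + 2\<close> and
      \<open>t + 1\<close>.\<close>
    define v where "v = w(t := x, Suc t := (s', a'))"
    have v: "v t = x" "v (Suc t) = (s', a')" "\<And>i. i < t \<Longrightarrow> v i = w i"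
      by (auto simp: v_def)
    have 1: "{\<xi>. \<forall>i<t. \<xi> i = w i} \<inter> ?E = {\<xi>. \<forall>i<Suc (Suc t). \<xi> i = v i}"
      by (auto simp: less_Suc_eq v)
    have 2: "{\<xi>. \<forall>i<t. \<xi> i = w i} \<inter> {\<xi>. \<xi> t = x} = {\<xi>. \<forall>i<Suc t. \<xi> i = v i}"
      by (auto simp: less_Suc_eq v)
    show ?thesis
      unfolding 1 2 measure_prefix prod.lessThan_Suc[of _ "Suc t"]
      by (simp add: step_kernel_def pmf_bind_pair v(1,2))
  qed
  then show ?thesis
    unfolding visit_def measure_split_prefix[OF E, of t]
      measure_split_prefix[OF coordinate_in_sets[of t x \<tau> \<mu>0 \<pi>], of t]
    by (simp add: sum_distrib_right)
qed

lemma sum_UNIV_prod: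
  "(\<Sum>x\<in>UNIV. f x) = (\<Sum>s\<in>UNIV. \<Sum>a\<in>UNIV. f (s :: 's::finite, a :: 'a::finite))"
  by (simp add: sum.cartesian_product)

lemma visit_Suc:
  fixes \<tau> :: "('s::finite, 'a::finite) transition"
  shows "visit \<tau> \<mu>0 \<pi> (Suc t) (s', a') =
    pmf (\<pi> s') a' * (\<Sum>x\<in>UNIV. visit \<tau> \<mu>0 \<pi> t x * pmf (\<tau> (fst x) (snd x)) s')"
proof -
  interpret prob_space "trajectories \<tau> \<mu>0 \<pi>" by (rule prob_space_trajectories)
  have "{\<xi>. \<xi> (Suc t) = (s', a')} = (\<Union>x. {\<xi>. \<xi> t = x \<and> \<xi> (Suc t) = (s', a')})" by auto
  then have "visit \<tau> \<mu>0 \<pi> (Suc t) (s', a') =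
      (\<Sum>x\<in>UNIV. measure (trajectories \<tau> \<mu>0 \<pi>) {\<xi>. \<xi> t = x \<and> \<xi> (Suc t) = (s', a')})"
    unfolding visit_def using transition_in_sets
    by (simp only:) (rule finite_measure_finite_Union, auto simp: disjoint_family_on_def)
  then show ?thesis
    by (simp add: measure_transition sum_distrib_left mult_ac)
qed

lemma visit_nonneg: "0 \<le> visit \<tau> \<mu>0 \<pi> t x"
  by (simp add: visit_def)

lemma visit_le_1: "visit \<tau> \<mu>0 \<pi> t x \<le> 1"
  unfolding visit_def by (rule prob_space.prob_le_1[OF prob_space_trajectories])


section \<open>Policy values as linear functions of the occupancy measure\<close>

definition mean_reward :: "('s, 'a) transition \<Rightarrow> ('s, 'a) reward \<Rightarrow> 's \<times> 'a \<Rightarrow> real" where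
  "mean_reward \<tau> R x =
     measure_pmf.expectation (\<tau> (fst x) (snd x)) (\<lambda>s'. R (fst x) (snd x) s')"

lemma mean_reward_eq:
  fixes \<tau> :: "('s::finite, 'a) transition"
  shows "mean_reward \<tau> R (s, a) = (\<Sum>s'\<in>UNIV. pmf (\<tau> s a) s' * R s a s')"
  unfolding mean_reward_def
  by (subst integral_measure_pmf_real[of UNIV]) (auto simp: mult.commute)

lemma sum_pmf_UNIV: "(\<Sum>x\<in>UNIV. pmf p (x :: 'x::finite)) = 1"
  by (rule sum_pmf_eq_1) auto

text \<open>The integrand depends only on the pair \<open>(\<xi> t, \<xi> (Suc t))\<close>, so it is
  a finite combination of indicators of transition events. Summing out the next action, whose
  probabilities add up to 1, leaves the mean over the next state.\<close>

lemma expectation_step_reward: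
  fixes \<tau> :: "('s::finite, 'a::finite) transition"
  shows "(\<integral>\<xi>. R (fst (\<xi> t)) (snd (\<xi> t)) (fst (\<xi> (Suc t))) \<partial>trajectories \<tau> \<mu>0 \<pi>) =
    (\<Sum>x\<in>UNIV. visit \<tau> \<mu>0 \<pi> t x * mean_reward \<tau> R x)"
proof -
  interpret prob_space "trajectories \<tau> \<mu>0 \<pi>" by (rule prob_space_trajectories)
  let ?E = "\<lambda>x y. {\<xi> :: nat \<Rightarrow> 's \<times> 'a. \<xi> t = x \<and> \<xi> (Suc t) = y}"
  have m: "?E x y \<in> sets (trajectories \<tau> \<mu>0 \<pi>)" for x y
    by (rule transition_in_sets)
  define g where "g x y \<xi> = indicator (?E x y) \<xi> * R (fst x) (snd x) (fst y)" for x y \<xi>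
  have g: "integrable (trajectories \<tau> \<mu>0 \<pi>) (g x y)"
    "expectation (g x y) = prob (?E x y) * R (fst x) (snd x) (fst y)" for x y
    using m[of x y] by (simp_all add: g_def[abs_def] less_top[symmetric])
  have "R (fst (\<xi> t)) (snd (\<xi> t)) (fst (\<xi> (Suc t))) = (\<Sum>x\<in>UNIV. \<Sum>y\<in>UNIV. g x y \<xi>)" for \<xi>
  proof -
    have "(\<Sum>y\<in>UNIV. g x y \<xi>) =
        (if \<xi> t = x then R (fst x) (snd x) (fst (\<xi> (Suc t))) else 0)" for x
      unfolding g_def
      by (subst sum.mono_neutral_right[of _ "{\<xi> (Suc t)}"]) (auto simp: indicator_def)
    then show ?thesis by simp
  qed
  then have "(\<integral>\<xi>. R (fst (\<xi> t)) (snd (\<xi> t)) (fst (\<xi> (Suc t))) \<partial>trajectories \<tau> \<mu>0 \<pi>) =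
      (\<Sum>x\<in>UNIV. \<Sum>y\<in>UNIV. prob (?E x y) * R (fst x) (snd x) (fst y))"
    by (simp add: Bochner_Integration.integral_sum g)
  also have "\<dots> = (\<Sum>x\<in>UNIV. visit \<tau> \<mu>0 \<pi> t x * mean_reward \<tau> R x)"
  proof (rule sum.cong[OF refl])
    fix x :: "'s \<times> 'a"
    have "(\<Sum>y\<in>UNIV. prob (?E x y) * R (fst x) (snd x) (fst y)) =
      (\<Sum>s\<in>UNIV. \<Sum>a\<in>UNIV.
         pmf (\<pi> s) a * (visit \<tau> \<mu>0 \<pi> t x * (pmf (\<tau> (fst x) (snd x)) s * R (fst x) (snd x) s)))"
      by (simp add: sum_UNIV_prod measure_transition mult_ac)
    also have "\<dots> = visit \<tau> \<mu>0 \<pi> t x * mean_reward \<tau> R x"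
      by (cases x) (simp add: mean_reward_eq sum_distrib_left sum_pmf_UNIV flip: sum_distrib_right)
    finally show "(\<Sum>y\<in>UNIV. prob (?E x y) * R (fst x) (snd x) (fst y)) =
      visit \<tau> \<mu>0 \<pi> t x * mean_reward \<tau> R x" .
  qed
  finally show ?thesis .
qed

text \<open>The measure is left unnormalised: for 0 < \<gamma> < 1 its total mass is 1 / (1 -
  \<gamma>), and the policy value is its inner product with the mean reward, with no extra
  factor.\<close>

definition occupancy ::
  "('s, 'a) transition \<Rightarrow> 's pmf \<Rightarrow> real \<Rightarrow> ('s, 'a) policy \<Rightarrow> 's \<times> 'a \<Rightarrow> real" where
  "occupancy \<tau> \<mu>0 \<gamma> \<pi> x = (\<Sum>t. \<gamma> ^ t * visit \<tau> \<mu>0 \<pi> t x)"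

lemma summable_visit:
  assumes "0 < \<gamma>" "\<gamma> < 1"
  shows "summable (\<lambda>t. \<gamma> ^ t * visit \<tau> \<mu>0 \<pi> t x)"
proof (rule summable_comparison_test'[of "\<lambda>t. \<gamma> ^ t" 0])
  show "summable (\<lambda>t. \<gamma> ^ t)" using assms by (intro summable_geometric) auto
  show "norm (\<gamma> ^ t * visit \<tau> \<mu>0 \<pi> t x) \<le> \<gamma> ^ t" for t
    using assms visit_nonneg[of \<tau> \<mu>0 \<pi> t x] visit_le_1[of \<tau> \<mu>0 \<pi> t x]
    by (simp add: abs_mult mult_left_le)
qed

lemma occupancy_nonneg:
  assumes "0 < \<gamma>" "\<gamma> < 1"
  shows "0 \<le> occupancy \<tau> \<mu>0 \<gamma> \<pi> x"
  unfolding occupancy_def using assms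
  by (intro suminf_nonneg summable_visit mult_nonneg_nonneg visit_nonneg) auto

text \<open>On finite sets the reward is bounded, so the geometric series dominates the discounted
  sum. This justifies exchanging expectation and series, and afterwards series and finite
  sum.\<close>

lemma policy_value_eq_occupancy:
  fixes \<tau> :: "('s::finite, 'a::finite) transition"
  assumes "0 < \<gamma>" "\<gamma> < 1"
  shows "policy_value \<tau> \<mu>0 \<gamma> R \<pi> =
    (\<Sum>x\<in>UNIV. occupancy \<tau> \<mu>0 \<gamma> \<pi> x * mean_reward \<tau> R x)"
proof -
  interpret prob_space "trajectories \<tau> \<mu>0 \<pi>" by (rule prob_space_trajectories)
  define B where "B = Max (range (\<lambda>(s, a, s'). \<bar>R s a s'\<bar>))"
  have B: "\<bar>R s a s'\<bar> \<le> B" for s a s'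
    unfolding B_def by (rule Max_ge) (auto intro: image_eqI[of _ _ "(s, a, s')"])
  define f where "f t \<xi> = \<gamma> ^ t * R (fst (\<xi> t)) (snd (\<xi> t)) (fst (\<xi> (Suc t)))" for t \<xi>
  have gs: "summable (\<lambda>t. \<gamma> ^ t * B)"
    using assms by (intro summable_mult2 summable_geometric) auto
  have le: "norm (f t \<xi>) \<le> \<gamma> ^ t * B" for t \<xi>
    unfolding f_def using assms B by (simp add: abs_mult mult_left_mono)
  have meas: "f t \<in> borel_measurable (trajectories \<tau> \<mu>0 \<pi>)" for t
  proof -
    have "(\<lambda>\<xi>. (\<xi> t, \<xi> (Suc t))) \<in> measurable (trajectories \<tau> \<mu>0 \<pi>) (count_space UNIV)"
      using measurable_Pair[OF measurable_coordinate[of t \<tau> \<mu>0 \<pi>]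
          measurable_coordinate[of "Suc t" \<tau> \<mu>0 \<pi>]]
      by (simp add: pair_measure_countable)
    from measurable_compose[OF this, of "\<lambda>(x, y). \<gamma> ^ t * R (fst x) (snd x) (fst y)" borel]
    show ?thesis by (simp add: f_def[abs_def])
  qed
  have int: "integrable (trajectories \<tau> \<mu>0 \<pi>) (f t)" for t
    using le meas by (intro integrable_const_bound[of _ "\<gamma> ^ t * B"]) auto
  have sn: "summable (\<lambda>t. norm (f t \<xi>))" for \<xi>
    using le by (intro summable_comparison_test'[OF gs]) auto
  have "norm (\<integral>\<xi>. norm (f t \<xi>) \<partial>trajectories \<tau> \<mu>0 \<pi>) \<le> \<gamma> ^ t * B" for t
  proof -
    have "(\<integral>\<xi>. norm (f t \<xi>) \<partial>trajectories \<tau> \<mu>0 \<pi>) \<le> (\<integral>\<xi>. \<gamma> ^ t * B \<partial>trajectories \<tau> \<mu>0 \<pi>)"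
      using int le by (intro integral_mono) auto
    then show ?thesis using prob_space by simp
  qed
  then have si: "summable (\<lambda>t. \<integral>\<xi>. norm (f t \<xi>) \<partial>trajectories \<tau> \<mu>0 \<pi>)"
    by (intro summable_comparison_test'[OF gs]) auto
  have "policy_value \<tau> \<mu>0 \<gamma> R \<pi> = (\<integral>\<xi>. (\<Sum>t. f t \<xi>) \<partial>trajectories \<tau> \<mu>0 \<pi>)"
    by (simp add: policy_value_def discounted_return_def f_def)
  also have "\<dots> = (\<Sum>t. \<integral>\<xi>. f t \<xi> \<partial>trajectories \<tau> \<mu>0 \<pi>)"
    using int sn si by (intro integral_suminf) auto
  also have "\<dots> = (\<Sum>t. \<Sum>x\<in>UNIV. \<gamma> ^ t * visit \<tau> \<mu>0 \<pi> t x * mean_reward \<tau> R x)"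
    by (simp add: f_def expectation_step_reward sum_distrib_left mult.assoc)
  also have "\<dots> = (\<Sum>x\<in>UNIV. \<Sum>t. \<gamma> ^ t * visit \<tau> \<mu>0 \<pi> t x * mean_reward \<tau> R x)"
    using summable_visit[OF assms] by (intro suminf_sum summable_mult2)
  also have "\<dots> = (\<Sum>x\<in>UNIV. occupancy \<tau> \<mu>0 \<gamma> \<pi> x * mean_reward \<tau> R x)"
    unfolding occupancy_def using summable_visit[OF assms]
    by (intro sum.cong refl suminf_mult2[symmetric])
  finally show ?thesis .
qed

section \<open>Flow equations and the occupancy measures that solve them\<close>

lemma occupancy_eq:
  fixes \<tau> :: "('s::finite, 'a::finite) transition"
  assumes "0 < \<gamma>" "\<gamma> < 1"
  shows "occupancy \<tau> \<mu>0 \<gamma> \<pi> (s, a) = pmf (\<pi> s) a *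
    (pmf \<mu>0 s + \<gamma> * (\<Sum>x\<in>UNIV. occupancy \<tau> \<mu>0 \<gamma> \<pi> x * pmf (\<tau> (fst x) (snd x)) s))"
proof -
  note sm = summable_visit[OF assms, of \<tau> \<mu>0 \<pi>]
  have "(\<Sum>t. \<gamma> ^ Suc t * visit \<tau> \<mu>0 \<pi> (Suc t) (s, a)) =
      (\<Sum>t. \<Sum>x\<in>UNIV. \<gamma> ^ t * visit \<tau> \<mu>0 \<pi> t x * (\<gamma> * pmf (\<pi> s) a * pmf (\<tau> (fst x) (snd x)) s))"
    by (simp add: visit_Suc sum_distrib_left mult_ac)
  also have "\<dots> = (\<Sum>x\<in>UNIV. \<Sum>t.
      \<gamma> ^ t * visit \<tau> \<mu>0 \<pi> t x * (\<gamma> * pmf (\<pi> s) a * pmf (\<tau> (fst x) (snd x)) s))"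
    using sm by (intro suminf_sum summable_mult2)
  also have "\<dots> = (\<Sum>x\<in>UNIV.
      occupancy \<tau> \<mu>0 \<gamma> \<pi> x * (\<gamma> * pmf (\<pi> s) a * pmf (\<tau> (fst x) (snd x)) s))"
    unfolding occupancy_def using sm by (intro sum.cong refl suminf_mult2[symmetric])
  also have "\<dots> = pmf (\<pi> s) a *
      (\<gamma> * (\<Sum>x\<in>UNIV. occupancy \<tau> \<mu>0 \<gamma> \<pi> x * pmf (\<tau> (fst x) (snd x)) s))"
    by (simp add: sum_distrib_left mult_ac)
  finally have "(\<Sum>t. \<gamma> ^ Suc t * visit \<tau> \<mu>0 \<pi> (Suc t) (s, a)) = \<dots>" .
  moreover have "occupancy \<tau> \<mu>0 \<gamma> \<pi> (s, a) =
      (\<Sum>t. \<gamma> ^ Suc t * visit \<tau> \<mu>0 \<pi> (Suc t) (s, a)) + visit \<tau> \<mu>0 \<pi> 0 (s, a)"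
    unfolding occupancy_def using suminf_split_head[OF sm[of "(s, a)"]] by simp
  ultimately show ?thesis by (simp add: visit_0 algebra_simps)
qed

text \<open>This is the operator of the balance constraints in the linear-programming formulation of
  discounted decision processes: mass at \<open>s\<close> minus the discounted mass entering
  \<open>s\<close>.\<close>

definition flow :: "('s::finite, 'a::finite) transition \<Rightarrow> real \<Rightarrow> ('s \<times> 'a \<Rightarrow> real) \<Rightarrow> 's \<Rightarrow> real" where
  "flow \<tau> \<gamma> m s =
     (\<Sum>a\<in>UNIV. m (s, a)) - \<gamma> * (\<Sum>x\<in>UNIV. m x * pmf (\<tau> (fst x) (snd x)) s)"

lemma flow_occupancy:
  assumes "0 < \<gamma>" "\<gamma> < 1"
  shows "flow \<tau> \<gamma> (occupancy \<tau> \<mu>0 \<gamma> \<pi>) s = pmf \<mu>0 s"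
proof -
  have "(\<Sum>a\<in>UNIV. occupancy \<tau> \<mu>0 \<gamma> \<pi> (s, a)) =
      pmf \<mu>0 s + \<gamma> * (\<Sum>x\<in>UNIV. occupancy \<tau> \<mu>0 \<gamma> \<pi> x * pmf (\<tau> (fst x) (snd x)) s)"
    by (subst occupancy_eq[OF assms]) (simp add: sum_pmf_UNIV flip: sum_distrib_right)
  then show ?thesis by (simp add: flow_def)
qed

text \<open>The difference \<open>d\<close> of two solutions satisfies \<open>\<parallel>d\<parallel>\<^sub>1 \<le> \<gamma> \<parallel>d\<parallel>\<^sub>1\<close>.\<close>

lemma occupancy_unique:
  fixes \<tau> :: "('s::finite, 'a::finite) transition"
  assumes \<gamma>: "0 < \<gamma>" "\<gamma> < 1"
    and m: "\<And>s a. m (s, a) = pmf (\<pi> s) a *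
      (pmf \<mu>0 s + \<gamma> * (\<Sum>x\<in>UNIV. m x * pmf (\<tau> (fst x) (snd x)) s))"
  shows "m = occupancy \<tau> \<mu>0 \<gamma> \<pi>"
proof -
  define d where "d x = m x - occupancy \<tau> \<mu>0 \<gamma> \<pi> x" for x
  have d: "d (s, a) = pmf (\<pi> s) a * (\<gamma> * (\<Sum>x\<in>UNIV. d x * pmf (\<tau> (fst x) (snd x)) s))" for s a
    unfolding d_def m[of s a] occupancy_eq[OF \<gamma>, of _ _ _ s a]
    by (simp add: algebra_simps sum_subtractf)
  have "(\<Sum>x\<in>UNIV. \<bar>d x\<bar>) = (\<Sum>s\<in>UNIV. \<Sum>a\<in>UNIV. \<bar>d (s, a)\<bar>)"
    by (rule sum_UNIV_prod)
  also have "\<dots> = (\<Sum>s\<in>UNIV. \<Sum>a\<in>UNIV. pmf (\<pi> s) a *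
      (\<gamma> * \<bar>\<Sum>x\<in>UNIV. d x * pmf (\<tau> (fst x) (snd x)) s\<bar>))"
    by (subst d) (use \<gamma> in \<open>simp add: abs_mult\<close>)
  also have "\<dots> = (\<Sum>s\<in>UNIV. \<gamma> * \<bar>\<Sum>x\<in>UNIV. d x * pmf (\<tau> (fst x) (snd x)) s\<bar>)"
    by (simp add: sum_pmf_UNIV flip: sum_distrib_right)
  also have "\<dots> \<le> (\<Sum>s\<in>UNIV. \<gamma> * (\<Sum>x\<in>UNIV. \<bar>d x\<bar> * pmf (\<tau> (fst x) (snd x)) s))"
    using \<gamma> by (intro sum_mono mult_left_mono order_trans[OF sum_abs]) (auto simp: abs_mult)
  also have "\<dots> = \<gamma> * (\<Sum>x\<in>UNIV. \<Sum>s\<in>UNIV. \<bar>d x\<bar> * pmf (\<tau> (fst x) (snd x)) s)"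
    by (subst sum.swap) (simp add: sum_distrib_left)
  also have "\<dots> = \<gamma> * (\<Sum>x\<in>UNIV. \<bar>d x\<bar>)"
    by (simp add: sum_pmf_UNIV flip: sum_distrib_left)
  finally have "(1 - \<gamma>) * (\<Sum>x\<in>UNIV. \<bar>d x\<bar>) \<le> 0" by (simp add: algebra_simps)
  then have "(\<Sum>x\<in>UNIV. \<bar>d x\<bar>) \<le> 0" using \<gamma> by (simp add: mult_le_0_iff)
  then have "(\<Sum>x\<in>UNIV. \<bar>d x\<bar>) = 0" by (intro antisym sum_nonneg) auto
  then show ?thesis by (auto simp: sum_nonneg_eq_0_iff d_def)
qed

text \<open>The policy is the conditional distribution of the action given the state under
  \<open>m\<close>; positivity of \<open>m\<close> makes every denominator nonzero. With this policy
  the flow equation becomes the fixed-point equation of \<open>occupancy_unique\<close>.\<close>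

lemma occupancy_surj:
  fixes \<tau> :: "('s::finite, 'a::finite) transition"
  assumes \<gamma>: "0 < \<gamma>" "\<gamma> < 1"
    and pos: "\<And>x. 0 < m x" and m: "\<And>s. flow \<tau> \<gamma> m s = pmf \<mu>0 s"
  obtains \<pi> where "occupancy \<tau> \<mu>0 \<gamma> \<pi> = m"
proof -
  have spos: "0 < (\<Sum>a\<in>UNIV. m (s, a))" for s by (rule sum_pos) (auto simp: pos)
  define \<pi> where "\<pi> s = embed_pmf (\<lambda>a. m (s, a) / (\<Sum>b\<in>UNIV. m (s, b)))" for s
  have \<pi>: "pmf (\<pi> s) a = m (s, a) / (\<Sum>b\<in>UNIV. m (s, b))" for s a
    unfolding \<pi>_def
  proof (rule pmf_embed_pmf)
    show nn: "0 \<le> m (s, x) / (\<Sum>b\<in>UNIV. m (s, b))" for x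
      using pos spos by (simp add: less_imp_le)
    have "(\<Sum>x\<in>UNIV. m (s, x) / (\<Sum>b\<in>UNIV. m (s, b))) = 1"
      using spos[of s] by (simp flip: sum_divide_distrib)
    then show "(\<integral>\<^sup>+ x. ennreal (m (s, x) / (\<Sum>b\<in>UNIV. m (s, b))) \<partial>count_space UNIV) = 1"
      by (simp add: nn_integral_count_space_finite nn)
  qed
  have "m = occupancy \<tau> \<mu>0 \<gamma> \<pi>"
  proof (rule occupancy_unique[OF \<gamma>])
    fix s a
    have "pmf \<mu>0 s + \<gamma> * (\<Sum>x\<in>UNIV. m x * pmf (\<tau> (fst x) (snd x)) s) = (\<Sum>a\<in>UNIV. m (s, a))"
      using m[of s] by (simp add: flow_def)
    then show "m (s, a) = pmf (\<pi> s) a *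
        (pmf \<mu>0 s + \<gamma> * (\<Sum>x\<in>UNIV. m x * pmf (\<tau> (fst x) (snd x)) s))"
      using spos[of s] by (simp add: \<pi>)
  qed
  with that show thesis by simp
qed

text \<open>By induction on reachability, a state receives mass either from the initial distribution
  or from one predecessor pair of positive occupancy. A policy with full support spreads this mass
  over all actions.\<close>

lemma occupancy_pos:
  fixes \<tau> :: "('s::finite, 'a::finite) transition"
  assumes \<gamma>: "0 < \<gamma>" "\<gamma> < 1"
    and "reachable \<tau> \<mu>0 s" and \<pi>: "\<And>s a. 0 < pmf (\<pi> s) a"
  shows "0 < occupancy \<tau> \<mu>0 \<gamma> \<pi> (s, a)"
  using \<open>reachable \<tau> \<mu>0 s\<close>
proof (induction arbitrary: a)
  case (init s)
  have "0 \<le> (\<Sum>x\<in>UNIV. occupancy \<tau> \<mu>0 \<gamma> \<pi> x * pmf (\<tau> (fst x) (snd x)) s)"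
    by (intro sum_nonneg mult_nonneg_nonneg occupancy_nonneg[OF \<gamma>]) auto
  moreover have "0 < pmf \<mu>0 s" using init by (simp add: pmf_positive)
  ultimately show ?case
    using \<gamma> \<pi> by (subst occupancy_eq[OF \<gamma>]) (simp add: add_pos_nonneg)
next
  case (step s s' b)
  have "0 < occupancy \<tau> \<mu>0 \<gamma> \<pi> (s, b) * pmf (\<tau> s b) s'"
    using step by (simp add: pmf_positive)
  also have "\<dots> = (\<Sum>x\<in>{(s, b)}. occupancy \<tau> \<mu>0 \<gamma> \<pi> x * pmf (\<tau> (fst x) (snd x)) s')" by simp
  also have "\<dots> \<le> (\<Sum>x\<in>UNIV. occupancy \<tau> \<mu>0 \<gamma> \<pi> x * pmf (\<tau> (fst x) (snd x)) s')"
    by (intro sum_mono2 mult_nonneg_nonneg occupancy_nonneg[OF \<gamma>]) auto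
  finally show ?case
    using \<gamma> \<pi> by (subst occupancy_eq[OF \<gamma>]) (simp add: add_nonneg_pos)
qed

lemma perturb_policy:
  fixes \<tau> :: "('s::finite, 'a::finite) transition"
  assumes \<gamma>: "0 < \<gamma>" "\<gamma> < 1" and reach: "\<forall>s. reachable \<tau> \<mu>0 s"
    and v: "\<And>s. flow \<tau> \<gamma> v s = 0"
  obtains \<pi> \<pi>' \<epsilon> where "0 < \<epsilon>"
    "\<And>x. occupancy \<tau> \<mu>0 \<gamma> \<pi>' x = occupancy \<tau> \<mu>0 \<gamma> \<pi> x + \<epsilon> * v x"
proof -
  \<comment> \<open>The uniform policy has full support and all states are reachable, so its
    occupancy measure lies in the interior of the positive orthant.\<close>
  define \<pi> :: "('s, 'a) policy" where "\<pi> = (\<lambda>_. pmf_of_set UNIV)"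
  define m where "m = occupancy \<tau> \<mu>0 \<gamma> \<pi>"
  define M where "M = Min (range m)"
  define B where "B = Max (range (\<lambda>x. \<bar>v x\<bar>))"
  have "0 < m (s, a)" for s a
    unfolding m_def by (rule occupancy_pos[OF \<gamma>]) (auto simp: reach \<pi>_def)
  then have "0 < m x" for x by (cases x) auto
  then have M: "0 < M" "M \<le> m x" for x by (auto simp: M_def)
  have B: "\<bar>v x\<bar> \<le> B" for x unfolding B_def by (rule Max_ge) auto
  then have B0: "0 \<le> B" by (meson abs_ge_zero order_trans)
  \<comment> \<open>\<open>M\<close> is the least entry of \<open>m\<close> and \<open>B\<close>
    bounds the entries of \<open>v\<close>. Dividing by \<open>B + 1\<close> also covers
    \<open>v = 0\<close> and makes the perturbation strictly smaller than \<open>M\<close>.\<close>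
  define \<epsilon> where "\<epsilon> = M / (B + 1)"
  have \<epsilon>: "0 < \<epsilon>" using M B0 by (simp add: \<epsilon>_def)
  have pos: "0 < m x + \<epsilon> * v x" for x
  proof -
    have "- (\<epsilon> * v x) \<le> \<epsilon> * B"
      using mult_left_mono[of "- v x" B \<epsilon>] B[of x] \<epsilon> by simp
    also have "\<dots> < \<epsilon> * (B + 1)" using \<epsilon> by simp
    also have "\<dots> = M" using B0 by (simp add: \<epsilon>_def)
    finally show ?thesis using M(2)[of x] by linarith
  qed
  have "flow \<tau> \<gamma> (\<lambda>x. m x + \<epsilon> * v x) s = flow \<tau> \<gamma> m s + \<epsilon> * flow \<tau> \<gamma> v s" for s
    by (simp add: flow_def sum.distrib sum_distrib_left algebra_simps)
  then have "flow \<tau> \<gamma> (\<lambda>x. m x + \<epsilon> * v x) s = pmf \<mu>0 s" for s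
    by (simp add: v m_def flow_occupancy[OF \<gamma>])
  from occupancy_surj[OF \<gamma> pos this] obtain \<pi>'
    where "occupancy \<tau> \<mu>0 \<gamma> \<pi>' = (\<lambda>x. m x + \<epsilon> * v x)" .
  with \<epsilon> show thesis by (intro that[of \<epsilon> \<pi>' \<pi>]) (auto simp: m_def)
qed


section \<open>Potential shaping\<close>

text \<open>The mean under \<open>\<tau>\<close> of the shaping term
  \<open>\<gamma> * \<Phi> s' - \<Phi> s\<close>, seen as a vector indexed by state-action
  pairs.\<close>

definition shaping ::
  "('s::finite, 'a::finite) transition \<Rightarrow> real \<Rightarrow> ('s \<Rightarrow> real) \<Rightarrow> 's \<times> 'a \<Rightarrow> real" where
  "shaping \<tau> \<gamma> \<Phi> x = \<gamma> * (\<Sum>s'\<in>UNIV. pmf (\<tau> (fst x) (snd x)) s' * \<Phi> s') - \<Phi> (fst x)"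

text \<open>Exchanging the order of summation moves the operator from \<open>\<Phi>\<close> to
  \<open>m\<close>. For an occupancy measure the right-hand side depends only on
  \<open>\<mu>0\<close> and \<open>\<Phi>\<close>, so shaping shifts all policy values equally; for
  a flow-free \<open>m\<close> it vanishes.\<close>

lemma sum_mult_shaping:
  "(\<Sum>x\<in>UNIV. m x * shaping \<tau> \<gamma> \<Phi> x) = - (\<Sum>s\<in>UNIV. flow \<tau> \<gamma> m s * \<Phi> s)"
proof -
  have "(\<Sum>x\<in>UNIV. m x * (\<Sum>s'\<in>UNIV. pmf (\<tau> (fst x) (snd x)) s' * \<Phi> s')) =
      (\<Sum>s'\<in>UNIV. (\<Sum>x\<in>UNIV. m x * pmf (\<tau> (fst x) (snd x)) s') * \<Phi> s')"
    unfolding sum_distrib_left sum_distrib_right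
    by (subst sum.swap) (simp add: mult_ac)
  moreover have "(\<Sum>x\<in>UNIV. m x * \<Phi> (fst x)) = (\<Sum>s\<in>UNIV. (\<Sum>a\<in>UNIV. m (s, a)) * \<Phi> s)"
    by (simp add: sum_UNIV_prod sum_distrib_right)
  moreover have "(\<Sum>x\<in>UNIV. m x * shaping \<tau> \<gamma> \<Phi> x) =
      \<gamma> * (\<Sum>x\<in>UNIV. m x * (\<Sum>s'\<in>UNIV. pmf (\<tau> (fst x) (snd x)) s' * \<Phi> s')) -
      (\<Sum>x\<in>UNIV. m x * \<Phi> (fst x))"
    by (simp add: shaping_def right_diff_distrib sum_subtractf sum_distrib_left mult_ac)
  moreover have "(\<Sum>s\<in>UNIV. flow \<tau> \<gamma> m s * \<Phi> s) =
      (\<Sum>s\<in>UNIV. (\<Sum>a\<in>UNIV. m (s, a)) * \<Phi> s) -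
      \<gamma> * (\<Sum>s'\<in>UNIV. (\<Sum>x\<in>UNIV. m x * pmf (\<tau> (fst x) (snd x)) s') * \<Phi> s')"
    by (simp add: flow_def algebra_simps sum_subtractf sum_distrib_left sum_distrib_right)
  ultimately show ?thesis by simp
qed

lemma mean_reward_shaping:
  fixes \<tau> :: "('s::finite, 'a::finite) transition"
  shows "mean_reward \<tau> (\<lambda>s a s'. R s a s' + \<gamma> * \<Phi> s' - \<Phi> s) x =
    mean_reward \<tau> R x + shaping \<tau> \<gamma> \<Phi> x"
proof (cases x)
  case (Pair s a)
  have "(\<Sum>s'\<in>UNIV. pmf (\<tau> s a) s' * (R s a s' + \<gamma> * \<Phi> s' - \<Phi> s)) =
      (\<Sum>s'\<in>UNIV. pmf (\<tau> s a) s' * R s a s') + \<gamma> * (\<Sum>s'\<in>UNIV. pmf (\<tau> s a) s' * \<Phi> s') -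
      (\<Sum>s'\<in>UNIV. pmf (\<tau> s a) s') * \<Phi> s"
    by (simp add: algebra_simps sum.distrib sum_subtractf sum_distrib_left sum_distrib_right)
  with Pair show ?thesis by (simp add: mean_reward_eq shaping_def sum_pmf_UNIV)
qed

lemma mean_reward_scale: "mean_reward \<tau> (\<lambda>s a s'. c * R s a s') x = c * mean_reward \<tau> R x"
  by (simp add: mean_reward_def)

text \<open>By \<open>sum_mult_shaping\<close>, a vector orthogonal to all shaping terms is flow-free.\<close>

lemma shaping_decomposition:
  fixes \<tau> :: "('s::finite, 'a::finite) transition"
  obtains \<Phi> z where "\<And>x. r x = shaping \<tau> \<gamma> \<Phi> x + z x" "\<And>s. flow \<tau> \<gamma> z s = 0"
proof -
  \<comment> \<open>The functions are encoded as Euclidean vectors so that orthogonal decomposition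
    along a subspace applies.\<close>
  define W :: "(real ^ ('s \<times> 'a)) set" where "W = range (\<lambda>\<Phi>. \<chi> x. shaping \<tau> \<gamma> \<Phi> x)"
  have "subspace W"
  proof (rule subspaceI)
    have "0 = (\<chi> x. shaping \<tau> \<gamma> (\<lambda>_. 0) x)" by (simp add: vec_eq_iff shaping_def)
    then show "0 \<in> W" by (auto simp: W_def)
  next
    fix u v assume "u \<in> W" "v \<in> W"
    then obtain \<Phi> \<Psi> where "u = (\<chi> x. shaping \<tau> \<gamma> \<Phi> x)" "v = (\<chi> x. shaping \<tau> \<gamma> \<Psi> x)"
      by (auto simp: W_def)
    then have "u + v = (\<chi> x. shaping \<tau> \<gamma> (\<lambda>s. \<Phi> s + \<Psi> s) x)"
      by (simp only:) (simp add: vec_eq_iff shaping_def algebra_simps sum.distrib)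
    then show "u + v \<in> W" by (auto simp: W_def)
  next
    fix c u assume "u \<in> W"
    then obtain \<Phi> where "u = (\<chi> x. shaping \<tau> \<gamma> \<Phi> x)" by (auto simp: W_def)
    then have "c *\<^sub>R u = (\<chi> x. shaping \<tau> \<gamma> (\<lambda>s. c * \<Phi> s) x)"
      by (simp only:) (simp add: vec_eq_iff shaping_def algebra_simps sum_distrib_left)
    then show "c *\<^sub>R u \<in> W" by (auto simp: W_def)
  qed
  obtain y z where y: "y \<in> span W" and z: "\<And>w. w \<in> span W \<Longrightarrow> orthogonal z w"
    and yz: "(\<chi> x. r x) = y + z"
    using orthogonal_subspace_decomp_exists[of W "\<chi> x. r x"] by blast
  from y \<open>subspace W\<close> obtain \<Phi> where \<Phi>: "y = (\<chi> x. shaping \<tau> \<gamma> \<Phi> x)"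
    by (auto simp: W_def span_eq_iff[THEN iffD2])
  have "flow \<tau> \<gamma> (($) z) s = 0" for s
  proof -
    \<comment> \<open>Testing orthogonality against the indicator potential of \<open>s\<close>
      isolates the flow of \<open>z\<close> at \<open>s\<close>, up to sign.\<close>
    let ?\<Psi> = "\<lambda>s'. if s' = s then 1 else 0 :: real"
    have "(\<chi> x. shaping \<tau> \<gamma> ?\<Psi> x) \<in> span W" by (intro span_base) (auto simp: W_def)
    from z[OF this] have "(\<Sum>x\<in>UNIV. z $ x * shaping \<tau> \<gamma> ?\<Psi> x) = 0"
      by (simp add: orthogonal_def inner_vec_def)
    then show ?thesis by (simp add: sum_mult_shaping if_distrib cong: if_cong)
  qed
  moreover have "r x = shaping \<tau> \<gamma> \<Phi> x + z $ x" for x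
    using arg_cong[OF yz, of "\<lambda>u. u $ x"] \<Phi> by simp
  ultimately show thesis using that by blast
qed

section \<open>From equal policy orderings to proportional mean rewards\<close>

lemma flow_combination:
  "flow \<tau> \<gamma> (\<lambda>x. u x - c * v x) s = flow \<tau> \<gamma> u s - c * flow \<tau> \<gamma> v s"
  by (simp add: flow_def algebra_simps sum_subtractf sum_distrib_left)

text \<open>Modulo shaping, the two mean rewards are flow-free vectors \<open>z1\<close> and
  \<open>z2\<close>. Both represent linear functionals on the flow-free space and lie in that space
  themselves, so they may serve as test directions; this forces \<open>z2\<close> to be a positive
  multiple of \<open>z1\<close>.\<close>

lemma ord_equiv_imp_mean_reward:
  fixes \<tau> :: "('s::finite, 'a::finite) transition"
  assumes \<gamma>: "0 < \<gamma>" "\<gamma> < 1" and reach: "\<forall>s. reachable \<tau> \<mu>0 s"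
    and ord: "ord_equiv \<tau> \<mu>0 \<gamma> R1 R2"
  obtains c \<Phi> where "0 < c"
    "\<And>x. mean_reward \<tau> R2 x = c * mean_reward \<tau> R1 x + shaping \<tau> \<gamma> \<Phi> x"
proof -
  obtain \<Phi>1 z1 where r1: "\<And>x. mean_reward \<tau> R1 x = shaping \<tau> \<gamma> \<Phi>1 x + z1 x"
    and z1: "\<And>s. flow \<tau> \<gamma> z1 s = 0"
    using shaping_decomposition by blast
  obtain \<Phi>2 z2 where r2: "\<And>x. mean_reward \<tau> R2 x = shaping \<tau> \<gamma> \<Phi>2 x + z2 x"
    and z2: "\<And>s. flow \<tau> \<gamma> z2 s = 0"
    using shaping_decomposition by blast
  define ip :: "('s \<times> 'a \<Rightarrow> real) \<Rightarrow> ('s \<times> 'a \<Rightarrow> real) \<Rightarrow> real"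
    where "ip u v = (\<Sum>x\<in>UNIV. u x * v x)" for u v
  have ip_self: "0 < ip u u \<or> (\<forall>x. u x = 0)" for u
  proof -
    have "0 \<le> ip u u" by (auto simp: ip_def intro: sum_nonneg)
    moreover have "ip u u = 0 \<longleftrightarrow> (\<forall>x. u x = 0)"
      by (simp add: ip_def sum_nonneg_eq_0_iff)
    ultimately show ?thesis by (auto simp: less_le)
  qed
  have same_sign: "0 < ip v z1 \<longleftrightarrow> 0 < ip v z2" if v: "\<And>s. flow \<tau> \<gamma> v s = 0" for v
  proof -
    obtain \<pi> \<pi>' \<epsilon> where \<epsilon>: "0 < \<epsilon>"
      and occ: "\<And>x. occupancy \<tau> \<mu>0 \<gamma> \<pi>' x = occupancy \<tau> \<mu>0 \<gamma> \<pi> x + \<epsilon> * v x"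
      by (rule perturb_policy[OF \<gamma> reach v]) (rule that)
    have "policy_value \<tau> \<mu>0 \<gamma> R \<pi>' = policy_value \<tau> \<mu>0 \<gamma> R \<pi> + \<epsilon> * ip v z"
      if "\<And>x. mean_reward \<tau> R x = shaping \<tau> \<gamma> \<Phi> x + z x" for R \<Phi> z
    proof -
      \<comment> \<open>The shaping part drops out because \<open>v\<close> is flow-free.\<close>
      have "ip v (mean_reward \<tau> R) = ip v z"
        using sum_mult_shaping[of v \<tau> \<gamma> \<Phi>]
        by (simp add: ip_def that distrib_left sum.distrib v)
      then show ?thesis
        unfolding policy_value_eq_occupancy[OF \<gamma>] occ
        by (simp add: ip_def distrib_right sum.distrib mult.assoc flip: sum_distrib_left)
    qed
    from this[OF r1] this[OF r2] show ?thesis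
      using ord[unfolded ord_equiv_def, rule_format, of \<pi> \<pi>'] \<epsilon>
      by (simp add: zero_less_mult_iff)
  qed
  obtain c where c: "0 < c" "\<And>x. z2 x = c * z1 x"
  proof (cases "\<forall>x. z1 x = 0")
    \<comment> \<open>If \<open>z1 = 0\<close>, then \<open>same_sign\<close> at \<open>z2\<close>
      gives \<open>z2 = 0\<close>, and any positive factor will do; 1 is taken.\<close>
    case True
    then have "\<not> 0 < ip z2 z2" using same_sign[OF z2] by (simp add: ip_def del: split_paired_All)
    with ip_self[of z2] True show thesis by (intro that[of 1]) (auto simp del: split_paired_All)
  next
    case False
    then have p1: "0 < ip z1 z1" using ip_self by blast
    \<comment> \<open>This is the coefficient of the orthogonal projection of \<open>z2\<close> onto
      \<open>z1\<close>. It is positive by \<open>same_sign\<close> in the direction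
      \<open>z1\<close>, and \<open>v\<close> below is the residual.\<close>
    define c where "c = ip z1 z2 / ip z1 z1"
    have c: "0 < c" using p1 same_sign[OF z1] by (simp add: c_def)
    define v where "v x = z2 x - c * z1 x" for x
    have fv: "flow \<tau> \<gamma> v s = 0" for s
      unfolding v_def[abs_def] flow_combination by (simp add: z1 z2)
    have ipv: "ip v w = ip z2 w - c * ip z1 w" "ip w v = ip w z2 - c * ip w z1" for w
      by (simp_all add: ip_def v_def algebra_simps sum_subtractf sum_distrib_left)
    have "ip z2 z1 = ip z1 z2" by (simp add: ip_def mult.commute)
    then have "ip v z1 = 0" using p1 by (simp add: ipv c_def)
    \<comment> \<open>The residual is orthogonal to \<open>z1\<close>, so its squared norm equals
      \<open>ip v z2\<close>. A nonzero residual would make this positive, and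
      \<open>same_sign\<close> would then give \<open>0 < ip v z1\<close>.\<close>
    then have "ip v v = ip v z2" "\<not> 0 < ip v z2"
      using same_sign[OF fv] by (simp_all add: ipv(2)[of v])
    with ip_self[of v] have "v x = 0" for x by (simp del: split_paired_All)
    with c show thesis by (intro that[of c]) (auto simp: v_def)
  qed
  show thesis
  proof (rule that[OF c(1)])
    fix x
    show "mean_reward \<tau> R2 x =
        c * mean_reward \<tau> R1 x + shaping \<tau> \<gamma> (\<lambda>s. \<Phi>2 s - c * \<Phi>1 s) x"
      unfolding r1 r2 c(2) shaping_def
      by (simp add: algebra_simps sum_subtractf sum_distrib_left)
  qed
qed


section \<open>Reward transformations\<close>

text \<open>Each of the three kinds of transformation changes policy values by an increasing affine
  map, and such maps are closed under composition. The coefficients may depend on \<open>R\<close>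
  but not on the policy.\<close>

lemma transformation_affine:
  fixes \<tau> :: "('s::finite, 'a::finite) transition"
  assumes \<gamma>: "0 < \<gamma>" "\<gamma> < 1"
    and t: "t \<in> redistribution \<tau> \<odot> potential_shaping \<gamma> \<odot> linear_scaling"
  shows "\<exists>c b. 0 < c \<and> (\<forall>\<pi>. policy_value \<tau> \<mu>0 \<gamma> (t R) \<pi> = c * policy_value \<tau> \<mu>0 \<gamma> R \<pi> + b)"
    (is "?aff t R")
proof -
  note J = policy_value_eq_occupancy[OF \<gamma>, of \<tau> \<mu>0]
  \<comment> \<open>The hypotheses range over all rewards because \<open>t\<close> is applied to
    \<open>u R\<close> and not to \<open>R\<close>; hence also the inductions below with
    \<open>R\<close> arbitrary.\<close>
  have comp_affine: "?aff (t \<circ> u) R" if t: "\<And>R. ?aff t R" and u: "\<And>R. ?aff u R" for t u R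
  proof -
    obtain c b where c: "0 < c"
      "\<And>\<pi>. policy_value \<tau> \<mu>0 \<gamma> (t (u R)) \<pi> = c * policy_value \<tau> \<mu>0 \<gamma> (u R) \<pi> + b"
      using t by blast
    obtain d e where d: "0 < d"
      "\<And>\<pi>. policy_value \<tau> \<mu>0 \<gamma> (u R) \<pi> = d * policy_value \<tau> \<mu>0 \<gamma> R \<pi> + e"
      using u by blast
    show ?thesis
      by (rule exI[of _ "c * d"], rule exI[of _ "c * e + b"])
         (simp add: c d algebra_simps)
  qed
  have red: "?aff t R" if "t \<in> redistribution \<tau>" for t R
  proof -
    have "mean_reward \<tau> (t R) x = mean_reward \<tau> R x" for x
      using that by (simp add: redistribution_def mean_reward_def)
    then show ?thesis by (intro exI[of _ 1] exI[of _ 0]) (simp add: J)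
  qed
  have ps: "?aff t R" if t: "t \<in> potential_shaping \<gamma>" for t R
  proof -
    obtain \<Phi> where "\<forall>s a s'. t R s a s' = R s a s' + \<gamma> * \<Phi> s' - \<Phi> s"
      using t unfolding potential_shaping_def by blast
    then have "t R = (\<lambda>s a s'. R s a s' + \<gamma> * \<Phi> s' - \<Phi> s)" by (intro ext) simp
    then show ?thesis
      \<comment> \<open>The common shift is minus the expected potential of the initial state, since
        the flow of every occupancy measure is \<open>\<mu>0\<close>.\<close>
      by (intro exI[of _ 1] exI[of _ "- (\<Sum>s\<in>UNIV. pmf \<mu>0 s * \<Phi> s)"])
         (simp add: J mean_reward_shaping distrib_left sum.distrib sum_mult_shaping
           flow_occupancy[OF \<gamma>])
  qed
  have ls: "?aff t R" if t: "t \<in> linear_scaling" for t R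
  proof -
    obtain c where "0 < c" "\<forall>s a s'. t R s a s' = c * R s a s'"
      using t unfolding linear_scaling_def by blast
    then have "0 < c" "t R = (\<lambda>s a s'. c * R s a s')" by (auto intro!: ext)
    then show ?thesis
      by (intro exI[of _ c] exI[of _ 0])
         (simp add: J mean_reward_scale sum_distrib_left mult_ac)
  qed
  have inner: "?aff t R" if "t \<in> redistribution \<tau> \<odot> potential_shaping \<gamma>" for t R
    using that
  proof (induction arbitrary: R)
    case (left t) then show ?case by (rule red)
  next
    case (right t) then show ?case by (rule ps)
  next
    case (comp t u) then show ?case by (intro comp_affine)
  qed
  show ?thesis
    using t
  proof (induction arbitrary: R)
    case (left t) then show ?case by (rule inner)
  next
    case (right t) then show ?case by (rule ls)
  next
    case (comp t u) then show ?case by (intro comp_affine)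
  qed
qed

theorem theorem2p6:
  fixes \<tau> :: "('s::finite, 'a::finite) transition"
    and \<mu>0 :: "'s pmf"
    and \<gamma> :: real
    and R1 R2 :: "('s, 'a) reward"
  assumes discount: "0 < \<gamma>" "\<gamma> \<le> 1"
    and reachable: "\<forall>s. reachable \<tau> \<mu>0 s"
    and welldefined: "\<forall>R \<pi>. policy_value_welldefined \<tau> \<mu>0 \<gamma> R \<pi>"
  shows "ord_equiv \<tau> \<mu>0 \<gamma> R1 R2 \<longleftrightarrow>
    (\<exists>t \<in> redistribution \<tau> \<odot> potential_shaping \<gamma> \<odot> linear_scaling. R2 = t R1)"
proof
  \<comment> \<open>Well-definedness for all rewards, in particular nonzero constant ones, excludes
    \<gamma> = 1.\<close>
  have \<gamma>: "0 < \<gamma>" "\<gamma> < 1"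
    using discount welldefined policy_value_welldefined_iff by blast+
  {
    assume "ord_equiv \<tau> \<mu>0 \<gamma> R1 R2"
    from ord_equiv_imp_mean_reward[OF \<gamma> reachable this] obtain c \<Phi> where c: "0 < c"
      and r2: "\<And>x. mean_reward \<tau> R2 x = c * mean_reward \<tau> R1 x + shaping \<tau> \<gamma> \<Phi> x"
      by blast
    define t1 :: "('s, 'a) transformation" where "t1 R = (\<lambda>s a s'. c * R s a s')" for R
    define t2 :: "('s, 'a) transformation"
      where "t2 R = (\<lambda>s a s'. R s a s' + \<gamma> * \<Phi> s' - \<Phi> s)" for R
    \<comment> \<open>A redistribution may treat each reward differently, so it suffices to send the
      single reward \<open>t2 (t1 R1)\<close> to \<open>R2\<close> and to fix all others. The
      condition at that reward is equality of mean rewards, which is \<open>r2\<close>.\<close>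
    define t3 :: "('s, 'a) transformation"
      where "t3 R = (if R = t2 (t1 R1) then R2 else R)" for R
    have "t1 \<in> linear_scaling" using c by (auto simp: linear_scaling_def t1_def)
    moreover have "t2 \<in> potential_shaping \<gamma>" by (auto simp: potential_shaping_def t2_def)
    moreover have "t3 \<in> redistribution \<tau>"
    proof -
      have "mean_reward \<tau> R2 (s, a) = mean_reward \<tau> (t2 (t1 R1)) (s, a)" for s a
        unfolding r2 t2_def mean_reward_shaping t1_def mean_reward_scale ..
      then show ?thesis by (auto simp: redistribution_def t3_def mean_reward_def)
    qed
    ultimately have "t3 \<circ> t2 \<circ> t1 \<in> redistribution \<tau> \<odot> potential_shaping \<gamma> \<odot> linear_scaling"
      by (blast intro: compositions.intros)
    moreover have "R2 = (t3 \<circ> t2 \<circ> t1) R1" by (simp add: t3_def)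
    ultimately show "\<exists>t \<in> redistribution \<tau> \<odot> potential_shaping \<gamma> \<odot> linear_scaling. R2 = t R1"
      by blast
  }
  {
    assume "\<exists>t \<in> redistribution \<tau> \<odot> potential_shaping \<gamma> \<odot> linear_scaling. R2 = t R1"
    with transformation_affine[OF \<gamma>] obtain c b where c: "0 < c"
      "\<And>\<pi>. policy_value \<tau> \<mu>0 \<gamma> R2 \<pi> = c * policy_value \<tau> \<mu>0 \<gamma> R1 \<pi> + b"
      by metis
    then show "ord_equiv \<tau> \<mu>0 \<gamma> R1 R2" by (simp add: ord_equiv_def)
  }
qed

end
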